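(* Let $A$ be any representative of an $\mathrm{SBIBD}(v,k,\lambda)$ and let $p\ge3$ be an integer. If $$v>(p-1)+\lambda\binom{p-1}{2}(k-2),$$ then $A$ contains a pairwise separated set of size $p$. For $p=3$, the condition becomes $\lambda(k-2)<v-2$.
   Context: For integers $1\le\lambda<k<v$, an $\mathrm{SBIBD}(v,k,\lambda)$ consists of $v$ points and $v$ blocks such that every block contains $k$ points, every point lies in $k$ blocks, and every two distinct points lie together in exactly $\lambda$ blocks. After independently labeling points and blocks by $0,1,\dots,v-1$, the incidence matrix $A=(A_{ij})\in\{0,1\}^{v\times v}$, with $A_{ij}=1$ iff point $i$ lies in block $j$, is called a representative of the SBIBD. For $F\subseteq\{0,\dots,v-1\}$ and $t\in\{0,\dots,v-1\}$ let $d_F(t)=\sum_{i\in F}A_{it}$. The set $F$ is pairwise separated if $d_F(t)\le2$ for every $t\in\{0,\dots,v-1\}$. *)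

theory Defs
  imports Main "Jordan_Normal_Form.Matrix"
begin

locale sbibd =
  fixes v k lam :: nat
    and Points :: "'p set" and Blocks :: "'b set"
    and inc :: "'p \<Rightarrow> 'b \<Rightarrow> bool"
  assumes parameters: "1 \<le> lam" "lam < k" "k < v"
    and card_Points: "card Points = v"
    and card_Blocks: "card Blocks = v"
    and block_size: "b \<in> Blocks \<Longrightarrow> card {x \<in> Points. inc x b} = k"
    and replication: "x \<in> Points \<Longrightarrow> card {b \<in> Blocks. inc x b} = k"
    and balance: "x \<in> Points \<Longrightarrow> y \<in> Points \<Longrightarrow> x \<noteq> y \<Longrightarrow>
      card {b \<in> Blocks. inc x b \<and> inc y b} = lam"

definition representative ::
  "'p set \<Rightarrow> 'b set \<Rightarrow> ('p \<Rightarrow> 'b \<Rightarrow> bool) \<Rightarrow> nat mat \<Rightarrow> bool" where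
  "representative Points Blocks inc A \<longleftrightarrow>
    (\<exists>pt bl. bij_betw pt {0..<card Points} Points \<and> bij_betw bl {0..<card Blocks} Blocks \<and>
      A = mat (card Points) (card Blocks) (\<lambda>(i, j). if inc (pt i) (bl j) then 1 else 0))"

definition col_count :: "nat mat \<Rightarrow> nat set \<Rightarrow> nat \<Rightarrow> nat" where
  "col_count A F t = (\<Sum>i\<in>F. A $$ (i, t))"

definition pairwise_separated :: "nat mat \<Rightarrow> nat set \<Rightarrow> bool" where
  "pairwise_separated A F \<longleftrightarrow>
    F \<subseteq> {0..<dim_row A} \<and> (\<forall>t\<in>{0..<dim_col A}. col_count A F t \<le> 2)"

end

theory Submission
  imports Defs
begin

text \<open>
  Greedy extension: a point outside a separated set \<open>S\<close> can be added unless it lies on a block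
  through two points of \<open>S\<close>. Each of the \<open>card S choose 2\<close> pairs is on \<open>lam\<close> blocks, and each such
  block carries \<open>k - 2\<close> further points, so few points are excluded.
\<close>

context sbibd
begin

lemma finite_Points: "finite Points"
  using card_Points parameters card.infinite by fastforce

lemma finite_Blocks: "finite Blocks"
  using card_Blocks parameters card.infinite by fastforce

text \<open>Unordered pairs are taken as two-element sets, so that \<open>n_subsets\<close> can
  later count each pair once.\<close>

lemma card_blocks_through_pair:
  assumes "T \<subseteq> Points" "card T = 2"
  shows "card {b \<in> Blocks. \<forall>x\<in>T. inc x b} = lam"
proof -
  obtain x y where "T = {x, y}" "x \<noteq> y"
    using assms(2) by (meson card_2_iff)
  then show ?thesis
    using balance[of x y] assms(1) by auto
qed

text \<open>Subtracting \<open>T\<close> leaves \<open>k - 2\<close> points per block instead of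
  \<open>k\<close>. This loses no candidate, since only points outside \<open>S\<close> are ever
  added.\<close>

definition excluded :: "'p set \<Rightarrow> 'p set" where
  "excluded S = (\<Union>T \<in> {T. T \<subseteq> S \<and> card T = 2}.
     \<Union>b \<in> {b \<in> Blocks. \<forall>x\<in>T. inc x b}. {x \<in> Points. inc x b} - T)"

lemma card_excluded_le:
  assumes S: "S \<subseteq> Points"
  shows "card (excluded S) \<le> lam * (card S choose 2) * (k - 2)"
proof -
  have finS: "finite S"
    using S finite_Points finite_subset by blast
  let ?B = "\<lambda>T. {b \<in> Blocks. \<forall>x\<in>T. inc x b}"
  let ?R = "\<lambda>T b. {x \<in> Points. inc x b} - T"
  have pair: "card (\<Union>b\<in>?B T. ?R T b) \<le> lam * (k - 2)" if T: "T \<subseteq> S" "card T = 2" for T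
  proof -
    have "card (\<Union>b\<in>?B T. ?R T b) \<le> (\<Sum>b\<in>?B T. card (?R T b))"
      by (rule card_UN_le) (simp add: finite_Blocks)
    also have "\<dots> = (\<Sum>b\<in>?B T. k - 2)"
    proof (rule sum.cong[OF refl])
      fix b assume b: "b \<in> ?B T"
      \<comment> \<open>The difference is exact because \<open>b\<close> passes through both points
        of \<open>T\<close>.\<close>
      have "card (?R T b) = card {x \<in> Points. inc x b} - card T"
        using b T S finS by (intro card_Diff_subset) (auto intro: finite_subset)
      then show "card (?R T b) = k - 2"
        using b T block_size by simp
    qed
    also have "\<dots> = lam * (k - 2)"
      using card_blocks_through_pair[of T] T S by auto
    finally show ?thesis .
  qed
  have "card (excluded S) \<le> (\<Sum>T\<in>{T. T \<subseteq> S \<and> card T = 2}. card (\<Union>b\<in>?B T. ?R T b))"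
    unfolding excluded_def by (rule card_UN_le) (simp add: finS)
  also have "\<dots> \<le> (\<Sum>T\<in>{T. T \<subseteq> S \<and> card T = 2}. lam * (k - 2))"
    by (rule sum_mono) (use pair in auto)
  also have "\<dots> = lam * (card S choose 2) * (k - 2)"
    by (simp add: n_subsets[OF finS])
  finally show ?thesis .
qed

text \<open>Only blocks through \<open>x\<close> gain a point. Such a block met \<open>S\<close> at
  most once before, as two points of \<open>S\<close> on it would form a pair that excludes
  \<open>x\<close>.\<close>

lemma separated_insert:
  assumes S: "S \<subseteq> Points" "\<forall>b\<in>Blocks. card {y \<in> S. inc y b} \<le> 2"
    and x: "x \<in> Points" "x \<notin> S" "x \<notin> excluded S" and b: "b \<in> Blocks"
  shows "card {y \<in> insert x S. inc y b} \<le> 2"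
proof (cases "inc x b")
  case True
  have "card {y \<in> S. inc y b} \<le> 1"
  proof (rule ccontr)
    assume "\<not> card {y \<in> S. inc y b} \<le> 1"
    then have "2 \<le> card {y \<in> S. inc y b}" by simp
    then obtain T where "T \<subseteq> {y \<in> S. inc y b}" "card T = 2"
      using obtain_subset_with_card_n by metis
    \<comment> \<open>As \<open>x\<close> is not in \<open>S\<close>, it is not in \<open>T\<close>
      and survives the subtraction of \<open>T\<close>.\<close>
    then have "x \<in> excluded S"
      using True x b unfolding excluded_def by auto
    then show False using x by simp
  qed
  moreover have "{y \<in> insert x S. inc y b} = insert x {y \<in> S. inc y b}"
    using True by auto
  ultimately show ?thesis
    using card_insert_le_m1[of 2 "{y \<in> S. inc y b}" x] by simp
next
  case False
  then have "{y \<in> insert x S. inc y b} = {y \<in> S. inc y b}" by auto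
  then show ?thesis using S b by simp
qed

lemma ex_separated_points:
  assumes "(p - 1) + lam * ((p - 1) choose 2) * (k - 2) < v"
  shows "\<exists>S \<subseteq> Points. card S = p \<and> (\<forall>b\<in>Blocks. card {y \<in> S. inc y b} \<le> 2)"
  using assms
proof (induction p)
  case 0
  show ?case by (rule exI[of _ "{}"]) simp
next
  case (Suc m)
  \<comment> \<open>The bound grows with the size, so the premise for \<open>Suc m\<close> yields
    the one for \<open>m\<close>. Truncated subtraction covers \<open>m = 0\<close>.\<close>
  have "(m - 1) + lam * ((m - 1) choose 2) * (k - 2) \<le> m + lam * (m choose 2) * (k - 2)"
    by (intro add_mono mult_le_mono binomial_right_mono) auto
  with Suc obtain S where S: "S \<subseteq> Points" "card S = m" "\<forall>b\<in>Blocks. card {y \<in> S. inc y b} \<le> 2"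
    by auto
  have finS: "finite S"
    using S(1) finite_Points finite_subset by blast
  \<comment> \<open>For \<open>p = Suc m\<close> the left side of the premise is exactly
    \<open>card S\<close> plus the bound on the excluded points.\<close>
  have "card (S \<union> excluded S) < card Points"
    using card_Un_le[of S "excluded S"] card_excluded_le[OF S(1)] S(2) Suc.prems card_Points
    by simp
  \<comment> \<open>Infinite sets have \<open>card\<close> 0, so the inequality alone would not show
    that a point is left over.\<close>
  moreover have "finite (S \<union> excluded S)"
    using finS finite_Blocks finite_Points by (auto simp: excluded_def)
  ultimately have "\<not> Points \<subseteq> S \<union> excluded S"
    using card_mono[of "S \<union> excluded S" Points] by linarith
  then obtain x where x: "x \<in> Points" "x \<notin> S" "x \<notin> excluded S"
    by blast
  show ?case
  proof (intro exI[of _ "insert x S"] conjI ballI)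
    show "insert x S \<subseteq> Points" "card (insert x S) = Suc m"
      using S x finS by simp_all
  qed (rule separated_insert[OF S(1,3) x])
qed

end

text \<open>Pull \<open>S\<close> back along the labeling \<open>pt\<close>: the sum of column
  \<open>t\<close> over the preimage counts the points of \<open>S\<close> on the block
  \<open>bl t\<close>.\<close>

lemma separated_points_imp_pairwise_separated:
  assumes "representative Points Blocks inc A"
    and S: "S \<subseteq> Points" "\<forall>b\<in>Blocks. card {y \<in> S. inc y b} \<le> 2"
  shows "\<exists>F. pairwise_separated A F \<and> card F = card S"
proof -
  obtain pt bl where pt: "bij_betw pt {0..<card Points} Points"
    and bl: "bij_betw bl {0..<card Blocks} Blocks"
    and A: "A = mat (card Points) (card Blocks) (\<lambda>(i, j). if inc (pt i) (bl j) then 1 else 0)"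
    using assms(1) unfolding representative_def by blast
  define F where "F = {i \<in> {0..<card Points}. pt i \<in> S}"
  have F: "F \<subseteq> {0..<card Points}" and finF: "finite F"
    by (auto simp: F_def)
  have img: "pt ` F = S"
    using pt S(1) unfolding F_def bij_betw_def by force
  have inj: "inj_on pt F"
    using pt F by (meson bij_betw_def inj_on_subset)
  have "col_count A F t \<le> 2" if t: "t \<in> {0..<card Blocks}" for t
  proof -
    have "col_count A F t = (\<Sum>i\<in>F. if inc (pt i) (bl t) then 1 else 0)"
      unfolding col_count_def by (rule sum.cong) (use F t in \<open>auto simp: A\<close>)
    also have "\<dots> = card {i \<in> F. inc (pt i) (bl t)}"
      using finF by (simp add: sum.If_cases Int_def)
    also have "\<dots> = card (pt ` {i \<in> F. inc (pt i) (bl t)})"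
      using inj by (intro card_image[symmetric]) (auto simp: inj_on_def)
    also have "pt ` {i \<in> F. inc (pt i) (bl t)} = {y \<in> S. inc y (bl t)}"
      using img by auto
    also have "card \<dots> \<le> 2"
      using S(2) t bl by (auto simp: bij_betw_def)
    finally show ?thesis .
  qed
  then have "pairwise_separated A F"
    using F by (simp add: pairwise_separated_def A)
  moreover have "card F = card S"
    using img inj card_image by metis
  ultimately show ?thesis by blast
qed

theorem propositionV1:
  fixes v k lam p :: nat
    and Points :: "'p set" and Blocks :: "'b set"
    and inc :: "'p \<Rightarrow> 'b \<Rightarrow> bool"
    and A :: "nat mat"
  assumes "sbibd v k lam Points Blocks inc"
    and "representative Points Blocks inc A"
    and "p \<ge> 3"
  shows "(int v > (int p - 1) + int lam * int ((p - 1) choose 2) * (int k - 2)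
            \<longrightarrow> (\<exists>F. pairwise_separated A F \<and> card F = p))
       \<and> (p = 3 \<longrightarrow>
            (int v > (int p - 1) + int lam * int ((p - 1) choose 2) * (int k - 2)
             \<longleftrightarrow> int lam * (int k - 2) < int v - 2))"
proof (intro conjI impI)
  interpret sbibd v k lam Points Blocks inc by fact
  assume less: "int v > (int p - 1) + int lam * int ((p - 1) choose 2) * (int k - 2)"
  \<comment> \<open>No truncation occurs: \<open>1 \<le> lam < k\<close> gives
    \<open>k \<ge> 2\<close>, and \<open>p \<ge> 3\<close>.\<close>
  have "int k - 2 = int (k - 2)" "int p - 1 = int (p - 1)"
    using parameters assms(3) by auto
  with less have "int ((p - 1) + lam * ((p - 1) choose 2) * (k - 2)) < int v"
    by (simp only: of_nat_add of_nat_mult mult.assoc)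
  then have "(p - 1) + lam * ((p - 1) choose 2) * (k - 2) < v"
    by (simp only: of_nat_less_iff)
  then show "\<exists>F. pairwise_separated A F \<and> card F = p"
    using ex_separated_points separated_points_imp_pairwise_separated[OF assms(2)] by metis
next
  assume "p = 3"
  \<comment> \<open>Two points form a single pair, so the threshold becomes
    \<open>2 + lam * (k - 2)\<close>.\<close>
  then have "(p - 1) choose 2 = 1" by simp
  with \<open>p = 3\<close> show "int v > (int p - 1) + int lam * int ((p - 1) choose 2) * (int k - 2)
             \<longleftrightarrow> int lam * (int k - 2) < int v - 2"
    by auto
qed

end
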